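(* Let $d\ge1$ and let $\Phi,\alpha,\beta:\mathbb{R}^d\to\mathbb{R}$ be given functions with $\alpha,\beta$ continuous, $\alpha>0$, and $\nabla\beta=-\alpha\nabla\Phi$. Let $\ell\ge0$ be an integer and $q=2+2\ell$. Consider, on a uniform Cartesian grid with cells $\Omega_j$, $j\in\mathbb{Z}^d$, the semidiscrete finite volume scheme for the $d$-dimensional Euler equations with gravity $$\frac{\mathrm{d}}{\mathrm{d}t}\overline{U}_j(t)=-K_j^\Delta(t)+\overline{S}_j^\Delta(t),$$ where $$K_j^\Delta=\sum_{k=1}^d\sum_p\omega_p\,\frac{\mathcal{F}^k\!\left(x_j+\Delta x(\tfrac12e_k+\xi_p^k)\right)-\mathcal{F}^k\!\left(x_j+\Delta x(-\tfrac12e_k+\xi_p^k)\right)}{\Delta x},$$ $\mathcal{F}^k(x)$ denotes any consistent numerical flux in direction $e_k$ evaluated on the two reconstructed states at the face point $x$, the source discretization $\overline{S}_j^\Delta$ is computed with the quadratures $\widetilde{Q}^q_{j,k}$ described in the context, namely $$\overline{S}_j^\Delta=\Big(0,\ \widetilde{Q}^q_{j,1}[\rho],\dots,\widetilde{Q}^q_{j,d}[\rho],\ \sum_{k=1}^d\widetilde{Q}^q_{j,k}[\rho v_k]\Big),$$ and the boundary extrapolated data are computed with the well-balanced reconstruction described in the context. Then the scheme is exactly well balanced on the hydrostatic equilibrium solution $\rho(x)=\alpha(x)$, $v(x)=0$, $p(x)=\beta(x)$; that is, if the cell averages are those of this equilibrium, the right-hand side of the scheme is exactly zero for every $j$.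
   Context: Equations: the Euler equations with gravity in $\mathbb{R}^d$ for an ideal gas with constant $\gamma>1$: $\partial_t\rho+\nabla\cdot(\rho v)=0$, $\partial_t(\rho v)+\nabla\cdot(\rho v\otimes v+pI)=-\rho\nabla\Phi$, $\partial_tE+\nabla\cdot(v(E+p))=-\rho v\cdot\nabla\Phi$, with $U=(\rho,\rho v_1,\dots,\rho v_d,E)$ and $p=(\gamma-1)\left(E-\tfrac12|\rho v|^2/\rho\right)$. The flux in direction $e_k$ (the $k$-th coordinate unit vector) is $f^k(U)=(\rho v_k,\ \rho v_kv+p\,e_k,\ v_k(E+p))$. Grid: $\Delta x>0$, $x_j=j\Delta x$ for $j\in\mathbb{Z}^d$, $\Omega_j=x_j+\Delta x[-\tfrac12,\tfrac12]^d$. An overbar with subscript $j$ denotes the average over $\Omega_j$. Face quadrature: $\omega_p$ and $\xi^k_p$ are the weights and nodes of a Gaussian quadrature rule on the $(d-1)$-dimensional cube $S^k=\{\xi\in[-\tfrac12,\tfrac12]^d:\ \xi\cdot e_k=0\}$. Reconstruction: a piecewise polynomial reconstruction assigns to cell averages $(\overline{g}_i)_{i\in\mathbb{Z}^d}$ a polynomial $g_j(x)$ in each cell $\Omega_j$; it reproduces constants exactly, so in particular it maps zero cell averages to the zero polynomial in every cell. Well-balanced reconstruction: (1) set $\overline{r}_j=\overline{\rho}_j-\overline{\alpha}_j$; (2) reconstruct $r_j(x)$ and $(\rho v_k)_j(x)$, $k=1,\dots,d$, from their cell averages; (3) set $\rho_j(x)=r_j(x)+\alpha(x)$; (4) with a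 fixed quadrature rule on each cell with nodes $x_{j,i}$ and weights $w_i$, set $\overline{K}_j=\frac12\sum_iw_i\,|(\rho v)_j(x_{j,i})|^2/\rho_j(x_{j,i})$ and $\overline{\pi}_j=(\gamma-1)(\overline{E}_j-\overline{K}_j)-\overline{\beta}_j$; (5) reconstruct $\pi_j(x)$ from $\overline{\pi}$ and set $p_j(x)=\pi_j(x)+\beta(x)$; (6) the reconstructed state $U_j(x)$ in $\Omega_j$ has density $\rho_j(x)$, momentum $(\rho v)_j(x)$ and energy $E_j(x)=\frac{p_j(x)}{\gamma-1}+\frac12|(\rho v)_j(x)|^2/\rho_j(x)$. Numerical flux: at a point $x$ on the face shared by $\Omega_j$ and $\Omega_{j+e_k}$, $\mathcal{F}^k(x)=\mathcal{F}^k(U_{j+e_k}(x),U_j(x))$, where the two-state function $\mathcal{F}^k$ is consistent: $\mathcal{F}^k(U,U)=f^k(U)$ for all states $U$. Source quadrature: for $y\in\{\rho,\rho v_1,\dots,\rho v_d\}$ with in-cell reconstruction $y_j(x)$, a direction $k$, a node index $p$ and $n=2^s$, $s\ge0$, let $z_i=x_j+\Delta x\big((-\tfrac12+\tfrac in)e_k+\xi^k_p\big)$, $i=0,\dots,n$, be the equispaced points on the segment joining $x_j+\Delta x(\pm\tfrac12e_k+\xi_p^k)$, and $$Q^{(0)}_{n}[y]=\sum_{i=1}^{n}\frac12\left(\frac{y_j(z_{i-1})}{\alpha(z_{i-1})}+\frac{y_j(z_i)}{\alpha(z_i)}\right)\frac{\beta(z_i)-\beta(z_{i-1})}{\Delta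 x}.$$ Romberg recursion: $Q^{(m)}_n[y]=\dfrac{2^{2m}Q^{(m-1)}_n[y]-Q^{(m-1)}_{n/2}[y]}{2^{2m}-1}$ for integers $m>0$ and $n=2^s$ with $s\ge m$. Set $Q^q_{j,k,p}[y]=Q^{(\ell)}_{2^\ell}[y]$ with $q=2+2\ell$, and $\widetilde{Q}^q_{j,k}[y]=\sum_p\omega_pQ^q_{j,k,p}[y]$ (an approximation of the cell average of $\frac{y}{\alpha}\partial_{x_k}\beta=-y\,\partial_{x_k}\Phi$). Equilibrium cell averages: $\overline{\rho}_j=\overline{\alpha}_j$, $\overline{(\rho v)}_j=0$, $\overline{E}_j=\overline{\beta}_j/(\gamma-1)$ for all $j$. *)

theory Defs
  imports "HOL-Analysis.Analysis"
begin

text \<open>Conserved variables \<open>(\<rho>, \<rho> v, E)\<close>.\<close>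

type_synonym 'd state = "real \<times> (real ^ 'd) \<times> real"

abbreviation mass_density :: "'d::finite state \<Rightarrow> real" where
  "mass_density U \<equiv> fst U"

abbreviation momentum :: "'d::finite state \<Rightarrow> real ^ 'd" where
  "momentum U \<equiv> fst (snd U)"

abbreviation energy :: "'d::finite state \<Rightarrow> real" where
  "energy U \<equiv> snd (snd U)"

definition pressure :: "real \<Rightarrow> 'd::finite state \<Rightarrow> real" where
  "pressure \<gamma> U = (\<gamma> - 1) * (energy U - 1 / 2 * (norm (momentum U))\<^sup>2 / mass_density U)"

definition euler_flux :: "real \<Rightarrow> 'd::finite \<Rightarrow> 'd state \<Rightarrow> 'd state" where
  "euler_flux \<gamma> k U =
    (let v = (1 / mass_density U) *\<^sub>R momentum U; p = pressure \<gamma> U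
     in (momentum U $ k,
         (momentum U $ k) *\<^sub>R v + p *\<^sub>R axis k 1,
         (v $ k) * (energy U + p)))"

text \<open>The flux is only defined where the density does not vanish, and states of a gas have
  positive density. No sign condition on the pressure is imposed, since none is imposed on the
  equilibrium pressure \<open>\<beta>\<close>.\<close>

definition consistent_flux ::
  "real \<Rightarrow> ('d::finite \<Rightarrow> 'd state \<Rightarrow> 'd state \<Rightarrow> 'd state) \<Rightarrow> bool" where
  "consistent_flux \<gamma> F \<longleftrightarrow> (\<forall>k U. mass_density U > 0 \<longrightarrow> F k U U = euler_flux \<gamma> k U)"

definition grid_point :: "real \<Rightarrow> int ^ 'd::finite \<Rightarrow> real ^ 'd" where
  "grid_point h j = (\<chi> i. h * of_int (j $ i))"

definition cell :: "real \<Rightarrow> int ^ 'd::finite \<Rightarrow> (real ^ 'd) set" where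
  "cell h j = cbox (grid_point h j - vec (h / 2)) (grid_point h j + vec (h / 2))"

definition cell_average :: "real \<Rightarrow> (real ^ 'd::finite \<Rightarrow> real) \<Rightarrow> int ^ 'd \<Rightarrow> real" where
  "cell_average h g j = integral (cell h j) g / measure lborel (cell h j)"

text \<open>Gauss--Legendre rule with \<open>m\<close> points on \<open>[-1/2, 1/2]\<close>: the points and weights are
  characterised by exactness for polynomials of degree at most \<open>2 m - 1\<close>.\<close>

definition gauss_rule :: "nat \<Rightarrow> (nat \<Rightarrow> real) \<Rightarrow> (nat \<Rightarrow> real) \<Rightarrow> bool" where
  "gauss_rule m b c \<longleftrightarrow>
     m > 0 \<and> inj_on c {..<m} \<and> c ` {..<m} \<subseteq> {-1/2..1/2} \<and>
     (\<forall>f :: real poly. degree f < 2 * m \<longrightarrow>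
        (\<Sum>i<m. b i * poly f (c i)) = integral {-1/2..1/2} (poly f))"

text \<open>Tensor-product Gauss rule on each of the \<open>(d - 1)\<close>-dimensional cubes
  \<open>S\<^sup>k = {\<xi> \<in> [-1/2, 1/2]\<^sup>d. \<xi>\<^sub>k = 0}\<close>: the index \<open>p < P\<close> enumerates, for each direction \<open>k\<close>, the
  multi-indices over the coordinates other than \<open>k\<close>. For \<open>d = 1\<close> this is the single node \<open>0\<close>
  with weight \<open>1\<close>.\<close>

definition gauss_face_rule ::
  "nat \<Rightarrow> (nat \<Rightarrow> real) \<Rightarrow> ('d::finite \<Rightarrow> nat \<Rightarrow> real ^ 'd) \<Rightarrow> bool" where
  "gauss_face_rule P \<omega> \<xi> \<longleftrightarrow>
     (\<exists>m b c. gauss_rule m b c \<and>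
       (\<forall>k. \<exists>\<mu>. bij_betw \<mu> {..<P} (Pi\<^sub>E (UNIV - {k}) (\<lambda>_. {..<m})) \<and>
         (\<forall>p<P. \<omega> p = (\<Prod>i\<in>UNIV - {k}. b (\<mu> p i)) \<and>
                \<xi> k p = (\<chi> i. if i = k then 0 else c (\<mu> p i)))))"

text \<open>A reconstruction \<open>R\<close> maps a family of cell averages to one polynomial function per cell;
  it need not be linear.\<close>

type_synonym 'd recon = "(int ^ 'd \<Rightarrow> real) \<Rightarrow> int ^ 'd \<Rightarrow> real ^ 'd \<Rightarrow> real"

definition polynomial_reconstruction :: "'d::finite recon \<Rightarrow> bool" where
  "polynomial_reconstruction R \<longleftrightarrow>
     (\<forall>g j. real_polynomial_function (R g j)) \<and>
     (\<forall>a j. R (\<lambda>_. a) j = (\<lambda>_. a))"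

text \<open>Well-balanced reconstruction. The cell quadrature has weights \<open>w i\<close> and nodes \<open>y j i\<close>
  in the cell \<open>j\<close>, for \<open>i < M\<close>.\<close>

definition rec_density ::
  "real \<Rightarrow> (real ^ 'd::finite \<Rightarrow> real) \<Rightarrow> 'd recon \<Rightarrow> (int ^ 'd \<Rightarrow> 'd state)
    \<Rightarrow> int ^ 'd \<Rightarrow> real ^ 'd \<Rightarrow> real" where
  "rec_density h \<alpha> R U j x = R (\<lambda>i. mass_density (U i) - cell_average h \<alpha> i) j x + \<alpha> x"

definition rec_momentum ::
  "'d::finite recon \<Rightarrow> (int ^ 'd \<Rightarrow> 'd state) \<Rightarrow> int ^ 'd \<Rightarrow> real ^ 'd \<Rightarrow> real ^ 'd" where
  "rec_momentum R U j x = (\<chi> k. R (\<lambda>i. momentum (U i) $ k) j x)"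

definition kinetic_average ::
  "real \<Rightarrow> (real ^ 'd::finite \<Rightarrow> real) \<Rightarrow> 'd recon
    \<Rightarrow> nat \<Rightarrow> (nat \<Rightarrow> real) \<Rightarrow> (int ^ 'd \<Rightarrow> nat \<Rightarrow> real ^ 'd)
    \<Rightarrow> (int ^ 'd \<Rightarrow> 'd state) \<Rightarrow> int ^ 'd \<Rightarrow> real" where
  "kinetic_average h \<alpha> R M w y U j =
     1 / 2 * (\<Sum>i<M. w i * (norm (rec_momentum R U j (y j i)))\<^sup>2 / rec_density h \<alpha> R U j (y j i))"

definition rec_pressure ::
  "real \<Rightarrow> real \<Rightarrow> (real ^ 'd::finite \<Rightarrow> real) \<Rightarrow> (real ^ 'd \<Rightarrow> real) \<Rightarrow> 'd recon
    \<Rightarrow> nat \<Rightarrow> (nat \<Rightarrow> real) \<Rightarrow> (int ^ 'd \<Rightarrow> nat \<Rightarrow> real ^ 'd)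
    \<Rightarrow> (int ^ 'd \<Rightarrow> 'd state) \<Rightarrow> int ^ 'd \<Rightarrow> real ^ 'd \<Rightarrow> real" where
  "rec_pressure \<gamma> h \<alpha> \<beta> R M w y U j x =
     R (\<lambda>i. (\<gamma> - 1) * (energy (U i) - kinetic_average h \<alpha> R M w y U i) - cell_average h \<beta> i) j x
     + \<beta> x"

definition rec_state ::
  "real \<Rightarrow> real \<Rightarrow> (real ^ 'd::finite \<Rightarrow> real) \<Rightarrow> (real ^ 'd \<Rightarrow> real) \<Rightarrow> 'd recon
    \<Rightarrow> nat \<Rightarrow> (nat \<Rightarrow> real) \<Rightarrow> (int ^ 'd \<Rightarrow> nat \<Rightarrow> real ^ 'd)
    \<Rightarrow> (int ^ 'd \<Rightarrow> 'd state) \<Rightarrow> int ^ 'd \<Rightarrow> real ^ 'd \<Rightarrow> 'd state" where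
  "rec_state \<gamma> h \<alpha> \<beta> R M w y U j x =
     (rec_density h \<alpha> R U j x,
      rec_momentum R U j x,
      rec_pressure \<gamma> h \<alpha> \<beta> R M w y U j x / (\<gamma> - 1)
        + 1 / 2 * (norm (rec_momentum R U j x))\<^sup>2 / rec_density h \<alpha> R U j x)"

text \<open>Numerical flux at a point of the face shared by the cells \<open>j\<close> and \<open>j + axis k 1\<close>, given the
  reconstructed states \<open>V\<close>.\<close>

definition face_flux ::
  "('d::finite \<Rightarrow> 'd state \<Rightarrow> 'd state \<Rightarrow> 'd state) \<Rightarrow> (int ^ 'd \<Rightarrow> real ^ 'd \<Rightarrow> 'd state)
    \<Rightarrow> 'd \<Rightarrow> int ^ 'd \<Rightarrow> real ^ 'd \<Rightarrow> 'd state" where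
  "face_flux F V k j x = F k (V (j + axis k 1) x) (V j x)"

definition flux_divergence ::
  "real \<Rightarrow> nat \<Rightarrow> (nat \<Rightarrow> real) \<Rightarrow> ('d::finite \<Rightarrow> nat \<Rightarrow> real ^ 'd)
    \<Rightarrow> ('d \<Rightarrow> 'd state \<Rightarrow> 'd state \<Rightarrow> 'd state) \<Rightarrow> (int ^ 'd \<Rightarrow> real ^ 'd \<Rightarrow> 'd state)
    \<Rightarrow> int ^ 'd \<Rightarrow> 'd state" where
  "flux_divergence h P \<omega> \<xi> F V j =
     (\<Sum>k\<in>UNIV. \<Sum>p<P. \<omega> p *\<^sub>R (1 / h) *\<^sub>R
        (face_flux F V k j (grid_point h j + h *\<^sub>R ((1 / 2) *\<^sub>R axis k 1 + \<xi> k p))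
         - face_flux F V k (j - axis k 1) (grid_point h j + h *\<^sub>R ((- 1 / 2) *\<^sub>R axis k 1 + \<xi> k p))))"

text \<open>Here \<open>g\<close> is the in-cell reconstruction of the quantity \<open>\<rho>\<close> or \<open>\<rho> v\<^sub>k\<close> in the cell \<open>j\<close>,
  and \<open>\<zeta>\<close> a face quadrature node.\<close>

definition segment_point ::
  "real \<Rightarrow> int ^ 'd::finite \<Rightarrow> 'd \<Rightarrow> real ^ 'd \<Rightarrow> nat \<Rightarrow> nat \<Rightarrow> real ^ 'd" where
  "segment_point h j k \<zeta> n i =
     grid_point h j + h *\<^sub>R ((- 1 / 2 + real i / real n) *\<^sub>R axis k 1 + \<zeta>)"

definition trapezoidal_source ::
  "real \<Rightarrow> (real ^ 'd::finite \<Rightarrow> real) \<Rightarrow> (real ^ 'd \<Rightarrow> real)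
    \<Rightarrow> int ^ 'd \<Rightarrow> 'd \<Rightarrow> real ^ 'd \<Rightarrow> (real ^ 'd \<Rightarrow> real) \<Rightarrow> nat \<Rightarrow> real" where
  "trapezoidal_source h \<alpha> \<beta> j k \<zeta> g n =
     (let z = segment_point h j k \<zeta> n in
      \<Sum>i=1..n. 1 / 2 * (g (z (i - 1)) / \<alpha> (z (i - 1)) + g (z i) / \<alpha> (z i))
               * ((\<beta> (z i) - \<beta> (z (i - 1))) / h))"

text \<open>Romberg extrapolation of a family \<open>Q\<close> indexed by the number of subintervals; it is meant
  for \<open>n = 2 ^ s\<close> with \<open>s \<ge> m\<close>, so that the halving is exact.\<close>

fun romberg :: "(nat \<Rightarrow> real) \<Rightarrow> nat \<Rightarrow> nat \<Rightarrow> real" where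
  "romberg Q 0 n = Q n"
| "romberg Q (Suc m) n =
     (2 ^ (2 * Suc m) * romberg Q m n - romberg Q m (n div 2)) / (2 ^ (2 * Suc m) - 1)"

text \<open>Approximates the cell average of \<open>(g / \<alpha>) \<partial>\<^sub>k \<beta> = - g \<partial>\<^sub>k \<Phi>\<close>; the order is \<open>q = 2 + 2 l\<close>.\<close>

definition source_quadrature ::
  "nat \<Rightarrow> real \<Rightarrow> (real ^ 'd::finite \<Rightarrow> real) \<Rightarrow> (real ^ 'd \<Rightarrow> real)
    \<Rightarrow> nat \<Rightarrow> (nat \<Rightarrow> real) \<Rightarrow> ('d \<Rightarrow> nat \<Rightarrow> real ^ 'd)
    \<Rightarrow> int ^ 'd \<Rightarrow> 'd \<Rightarrow> (real ^ 'd \<Rightarrow> real) \<Rightarrow> real" where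
  "source_quadrature l h \<alpha> \<beta> P \<omega> \<xi> j k g =
     (\<Sum>p<P. \<omega> p * romberg (trapezoidal_source h \<alpha> \<beta> j k (\<xi> k p) g) l (2 ^ l))"

definition source_term ::
  "nat \<Rightarrow> real \<Rightarrow> (real ^ 'd::finite \<Rightarrow> real) \<Rightarrow> (real ^ 'd \<Rightarrow> real)
    \<Rightarrow> nat \<Rightarrow> (nat \<Rightarrow> real) \<Rightarrow> ('d \<Rightarrow> nat \<Rightarrow> real ^ 'd)
    \<Rightarrow> (int ^ 'd \<Rightarrow> real ^ 'd \<Rightarrow> 'd state) \<Rightarrow> int ^ 'd \<Rightarrow> 'd state" where
  "source_term l h \<alpha> \<beta> P \<omega> \<xi> V j =
     (0,
      (\<chi> k. source_quadrature l h \<alpha> \<beta> P \<omega> \<xi> j k (\<lambda>x. mass_density (V j x))),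
      (\<Sum>k\<in>UNIV. source_quadrature l h \<alpha> \<beta> P \<omega> \<xi> j k (\<lambda>x. momentum (V j x) $ k)))"

text \<open>Right-hand side of the semidiscrete scheme as a function of the cell averages \<open>U\<close>.\<close>

definition scheme_rhs ::
  "real \<Rightarrow> real \<Rightarrow> (real ^ 'd::finite \<Rightarrow> real) \<Rightarrow> (real ^ 'd \<Rightarrow> real) \<Rightarrow> 'd recon
    \<Rightarrow> nat \<Rightarrow> (nat \<Rightarrow> real) \<Rightarrow> (int ^ 'd \<Rightarrow> nat \<Rightarrow> real ^ 'd)
    \<Rightarrow> nat \<Rightarrow> (nat \<Rightarrow> real) \<Rightarrow> ('d \<Rightarrow> nat \<Rightarrow> real ^ 'd)
    \<Rightarrow> ('d \<Rightarrow> 'd state \<Rightarrow> 'd state \<Rightarrow> 'd state) \<Rightarrow> nat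
    \<Rightarrow> (int ^ 'd \<Rightarrow> 'd state) \<Rightarrow> int ^ 'd \<Rightarrow> 'd state" where
  "scheme_rhs \<gamma> h \<alpha> \<beta> R M w y P \<omega> \<xi> F l U j =
     (let V = rec_state \<gamma> h \<alpha> \<beta> R M w y U
      in - flux_divergence h P \<omega> \<xi> F V j + source_term l h \<alpha> \<beta> P \<omega> \<xi> V j)"

text \<open>Averages of the conserved variables of the hydrostatic equilibrium
  \<open>\<rho> = \<alpha>\<close>, \<open>v = 0\<close>, \<open>p = \<beta>\<close>, for which \<open>E = \<beta> / (\<gamma> - 1)\<close>.\<close>

definition equilibrium_averages ::
  "real \<Rightarrow> real \<Rightarrow> (real ^ 'd::finite \<Rightarrow> real) \<Rightarrow> (real ^ 'd \<Rightarrow> real)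
    \<Rightarrow> int ^ 'd \<Rightarrow> 'd state" where
  "equilibrium_averages \<gamma> h \<alpha> \<beta> j = (cell_average h \<alpha> j, 0, cell_average h \<beta> j / (\<gamma> - 1))"

end

theory Submission
  imports Defs
begin

text \<open>At equilibrium the deviations handed to the reconstruction vanish, so the reconstructed
  state is \<open>(\<alpha>, 0, \<beta> / (\<gamma> - 1))\<close> on both sides of every face, and by consistency the flux is
  \<open>(0, \<beta> e\<^sub>k, 0)\<close>. In the momentum source the trapezoidal summands have the factor \<open>\<alpha> / \<alpha> = 1\<close>, so
  every trapezoidal sum telescopes to the difference of \<open>\<beta>\<close> between the two faces divided by \<open>h\<close>.
  Romberg extrapolation reproduces this common value, which cancels the flux difference at each
  face node.\<close>

lemma polynomial_reconstruction_zero: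
  assumes "polynomial_reconstruction R"
  shows "R (\<lambda>_. 0) j x = 0"
  using assms by (simp add: polynomial_reconstruction_def)

text \<open>Each family of averages passed to \<open>R\<close> is identically zero: zero momentum
  makes the kinetic average vanish, so the pressure deviation does too.\<close>

lemma rec_state_equilibrium:
  assumes "polynomial_reconstruction R" and "\<gamma> \<noteq> 1"
  shows "rec_state \<gamma> h \<alpha> \<beta> R M w y (equilibrium_averages \<gamma> h \<alpha> \<beta>) j x
           = (\<alpha> x, 0, \<beta> x / (\<gamma> - 1))"
proof -
  note R0 = polynomial_reconstruction_zero[OF assms(1)]
  have mom: "rec_momentum R (equilibrium_averages \<gamma> h \<alpha> \<beta>) i z = 0" for i z
    by (simp add: rec_momentum_def equilibrium_averages_def R0 vec_eq_iff)
  have "rec_pressure \<gamma> h \<alpha> \<beta> R M w y (equilibrium_averages \<gamma> h \<alpha> \<beta>) j x = \<beta> x"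
    using assms(2)
    \<comment> \<open>\<open>mom\<close> matches only while the equilibrium averages are folded, so
      the kinetic term is removed before they are unfolded.\<close>
    by (simp add: rec_pressure_def kinetic_average_def mom)
       (simp add: equilibrium_averages_def R0)
  moreover have "rec_density h \<alpha> R (equilibrium_averages \<gamma> h \<alpha> \<beta>) j x = \<alpha> x"
    by (simp add: rec_density_def equilibrium_averages_def R0)
  ultimately show ?thesis
    by (simp add: rec_state_def mom)
qed

lemma euler_flux_at_rest:
  assumes "\<gamma> \<noteq> 1"
  shows "euler_flux \<gamma> k (a, 0, b / (\<gamma> - 1)) = (0, b *\<^sub>R axis k 1, 0)"
  using assms by (simp add: euler_flux_def pressure_def)

lemma trapezoidal_source_equilibrium:
  assumes "\<And>x. \<alpha> x \<noteq> 0" and "n > 0"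
  shows "trapezoidal_source h \<alpha> \<beta> j k \<zeta> \<alpha> n =
    (\<beta> (grid_point h j + h *\<^sub>R ((1 / 2) *\<^sub>R axis k 1 + \<zeta>))
      - \<beta> (grid_point h j + h *\<^sub>R ((- 1 / 2) *\<^sub>R axis k 1 + \<zeta>))) / h"
proof -
  let ?b = "\<lambda>i. \<beta> (segment_point h j k \<zeta> n i) / h"
  have "trapezoidal_source h \<alpha> \<beta> j k \<zeta> \<alpha> n = (\<Sum>i=Suc 0..n. ?b i - ?b (i - 1))"
    using assms(1) by (simp add: trapezoidal_source_def Let_def diff_divide_distrib)
  also have "\<dots> = ?b n - ?b 0"
    by (rule sum_telescope'') simp
  \<comment> \<open>With \<open>n > 0\<close>, \<open>real n / real n\<close> is 1, which places the
    last node on the far face.\<close>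
  finally show ?thesis
    using assms(2) by (simp add: segment_point_def diff_divide_distrib)
qed

lemma trapezoidal_source_zero: "trapezoidal_source h \<alpha> \<beta> j k \<zeta> (\<lambda>_. 0) n = 0"
  by (simp add: trapezoidal_source_def)

text \<open>The two extrapolation weights sum to 1. The bound \<open>m \<le> s\<close> keeps every
  halving exact, so \<open>Q\<close> is only evaluated at positive arguments.\<close>

lemma romberg_const:
  assumes "\<And>n. n > 0 \<Longrightarrow> Q n = c" and "m \<le> s"
  shows "romberg Q m (2 ^ s) = c"
  using assms(2)
proof (induction m arbitrary: s)
  case 0
  then show ?case by (simp add: assms(1))
next
  case (Suc m)
  then obtain t where t: "s = Suc t" "m \<le> t"
    by (cases s) auto
  have "(2::real) ^ (2 * Suc m) > 1"
    by (rule one_less_power) auto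
  then have "(2 ^ (2 * Suc m) * c - c) / (2 ^ (2 * Suc m) - 1) = c"
    by (simp add: divide_eq_eq algebra_simps)
  moreover have "romberg Q m (2 ^ s) = c" "romberg Q m (2 ^ s div 2) = c"
    using Suc.IH[of s] Suc.IH[of t] t by auto
  ultimately show ?case
    by (simp only: romberg.simps)
qed

theorem theorem3:
  fixes \<Phi> \<alpha> \<beta> :: "real ^ 'd::finite \<Rightarrow> real"
    and \<gamma> h :: real
    and R :: "'d recon"
    and M :: nat and w :: "nat \<Rightarrow> real" and y :: "int ^ 'd \<Rightarrow> nat \<Rightarrow> real ^ 'd"
    and P :: nat and \<omega> :: "nat \<Rightarrow> real" and \<xi> :: "'d \<Rightarrow> nat \<Rightarrow> real ^ 'd"
    and F :: "'d \<Rightarrow> 'd state \<Rightarrow> 'd state \<Rightarrow> 'd state"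
    and l :: nat
    and U :: "int ^ 'd \<Rightarrow> 'd state"
  assumes "\<gamma> > 1" and "h > 0"
    and "continuous_on UNIV \<alpha>" and "continuous_on UNIV \<beta>"
    and "\<And>x. \<alpha> x > 0"
    and "\<And>x. \<exists>g. (GDERIV \<Phi> x :> g) \<and> (GDERIV \<beta> x :> - \<alpha> x *\<^sub>R g)"
    and "polynomial_reconstruction R"
    and "\<And>j i. i < M \<Longrightarrow> y j i \<in> cell h j"
    and "gauss_face_rule P \<omega> \<xi>"
    and "consistent_flux \<gamma> F"
    and "\<And>j. U j = equilibrium_averages \<gamma> h \<alpha> \<beta> j"
  shows "\<forall>j. scheme_rhs \<gamma> h \<alpha> \<beta> R M w y P \<omega> \<xi> F l U j = 0"
proof
  fix j
  define V where "V = rec_state \<gamma> h \<alpha> \<beta> R M w y U"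
  define D where "D = (\<lambda>k p.
    (\<beta> (grid_point h j + h *\<^sub>R ((1 / 2) *\<^sub>R axis k 1 + \<xi> k p))
      - \<beta> (grid_point h j + h *\<^sub>R ((- 1 / 2) *\<^sub>R axis k 1 + \<xi> k p))) / h)"
  have \<gamma>: "\<gamma> \<noteq> 1"
    using assms(1) by simp
  have \<alpha>: "\<alpha> x \<noteq> 0" for x
    using assms(5)[of x] by simp
  have "U = equilibrium_averages \<gamma> h \<alpha> \<beta>"
    using assms(11) by blast
  then have V: "V i x = (\<alpha> x, 0, \<beta> x / (\<gamma> - 1))" for i x
    by (simp add: V_def rec_state_equilibrium[OF assms(7) \<gamma>])
  \<comment> \<open>\<open>V\<close> is independent of the cell, so both flux arguments agree;
    positivity of \<alpha> then permits the use of consistency.\<close>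
  have flux: "face_flux F V k i x = (0, \<beta> x *\<^sub>R axis k 1, 0)" for k i x
    using assms(5,10) by (simp add: face_flux_def V consistent_flux_def euler_flux_at_rest[OF \<gamma>])
  have "flux_divergence h P \<omega> \<xi> F V j
      = (\<Sum>k\<in>UNIV. \<Sum>p<P. (0, (\<omega> p * D k p) *\<^sub>R axis k 1, 0))"
    by (simp add: flux_divergence_def flux D_def flip: scaleR_diff_left)
  also have "\<dots> = (0, (\<Sum>k\<in>UNIV. \<Sum>p<P. (\<omega> p * D k p) *\<^sub>R axis k 1), 0)"
    by (simp add: prod_eq_iff fst_sum snd_sum)
  \<comment> \<open>Only direction \<open>k\<close> contributes to component \<open>k\<close>, which
    gives the componentwise form of the momentum source.\<close>
  also have "(\<Sum>k\<in>UNIV. \<Sum>p<P. (\<omega> p * D k p) *\<^sub>R axis k 1) = (\<chi> k. \<Sum>p<P. \<omega> p * D k p)"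
    by (simp add: vec_eq_iff axis_def if_distrib[of "(*) _"] sum.If_cases sum.delta
          flip: sum_distrib_right scaleR_sum_left cong: if_cong)
  finally have div: "flux_divergence h P \<omega> \<xi> F V j = (0, (\<chi> k. \<Sum>p<P. \<omega> p * D k p), 0)" .
  have "romberg (trapezoidal_source h \<alpha> \<beta> j k (\<xi> k p) \<alpha>) l (2 ^ l) = D k p" for k p
    unfolding D_def
    by (rule romberg_const[OF trapezoidal_source_equilibrium]) (use \<alpha> in auto)
  \<comment> \<open>This handles the energy source, whose integrand is the vanishing
    momentum.\<close>
  moreover have "romberg (trapezoidal_source h \<alpha> \<beta> j k (\<xi> k p) (\<lambda>_. 0)) l (2 ^ l) = 0" for k p
    by (rule romberg_const[OF trapezoidal_source_zero]) auto
  ultimately have "source_term l h \<alpha> \<beta> P \<omega> \<xi> V j = (0, (\<chi> k. \<Sum>p<P. \<omega> p * D k p), 0)"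
    by (simp add: source_term_def source_quadrature_def V)
  with div show "scheme_rhs \<gamma> h \<alpha> \<beta> R M w y P \<omega> \<xi> F l U j = 0"
    by (simp add: scheme_rhs_def V_def[symmetric] zero_prod_def)
qed

end
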